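(* Let $P_0$ be a probability distribution on a measurable space $\mathcal{Z}$, and let $\theta$ be a real-valued parameter of distributions on $\mathcal{Z}$ having influence function $\dot\theta_0 \in L^2(P_0)$ at $P_0$, i.e. $\mathbb{E}_0[\dot\theta_0(Z)] = 0$ and for every $g \in \mathcal{G}$, $$\theta(P_{t,g}) = \theta(P_0) + t\,\mathbb{E}_0[\dot\theta_0(Z) g(Z)] + o(t) \quad \text{as } t \to 0,$$ where $\mathcal{G}$ and the tilted distributions $P_{t,g}$ are as defined in the context. Let $K \in (0,\infty)$, $B > 2$ and $c \in (0,1)$ be constants. Let $\widehat\theta_n : \mathcal{Z}^n \to \mathbb{R}$ be a sequence of estimators satisfying $$P_0^n\left(\sqrt n\,|\widehat\theta_n(Z_1,\dots,Z_n) - \theta(P_0)| \ge K\right) \le \varepsilon_n \quad \text{for all } n,$$ where $\varepsilon_n \to 0$. Let $\delta_n \ge \varepsilon_n$ be any sequence of positive numbers satisfying $\delta_n \to 0$ and $n^{-1}\log \delta_n \to 0$. Define $$\mathcal{G}_0 = \left\{g \in \mathcal{G} \mid \mathbb{E}_0[\dot\theta_0(Z) g(Z)] \ne 0,\ \mathbb{E}_0[g(Z)^2] \le 1\right\}$$ and, for $g \in \mathcal{G}_0$, $$\mathcal{P}_{n,g} = \left\{P_{t,g} \;\middle|\; \frac{K^2}{n}\,\frac{B^2}{\mathbb{E}_0[\dot\theta_0(Z) g(Z)]^2} \le t^2 \le \frac{c}{n}\log\frac{1}{\delta_n}\right\}.$$ Then $$\inf_{g \in \mathcal{G}_0}\ \liminf_{n\to\infty}\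 \inf_{P \in \mathcal{P}_{n,g}} P^n\left(\sqrt n\,|\widehat\theta_n(Z_1,\dots,Z_n) - \theta(P)| \ge K\right) = 1 .$$
   Context: $\mathbb{E}_0$ denotes expectation under $P_0$ (with $Z \sim P_0$), and $P^n$ is the $n$-fold product of $P$, i.e. the law of i.i.d. $Z_1,\dots,Z_n \sim P$. Estimators are measurable functions. $\mathcal{G} \subset L^2(P_0)$ is the set of measurable $g : \mathcal{Z} \to \mathbb{R}$ with $\mathbb{E}_0[g(Z)] = 0$ and $\mathbb{E}_0[g(Z)^2] < \infty$. Fix a $\mathcal{C}^3$ function $\phi : \mathbb{R} \to [0,2]$ with $\phi(0) = 1$, $\phi'(0) = 1$, and $\|\phi'\|_\infty \le M$, $\|\phi''\|_\infty \le M$ for some constant $M < \infty$ (for example $\phi(t) = 2/(1+e^{-2t})$). For $g \in \mathcal{G}$ and $t \in \mathbb{R}$ (with $C_t > 0$, which holds for all small $|t|$), the tilted distribution $P_{t,g}$ is $$dP_{t,g}(z) = \frac{1}{C_t}\,\phi(t g(z))\,dP_0(z), \qquad C_t = \int \phi(t g(z))\,dP_0(z).$$ The parameter $\theta$ is assumed to be defined at $P_0$ and at the distributions $P_{t,g}$. Infima are of quantities in $[0,1]$, with the infimum over an empty set equal to $1$. *)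

theory Defs
  imports "HOL-Probability.Probability" "HOL-Library.Landau_Symbols"
begin

definition C3 :: "(real \<Rightarrow> real) \<Rightarrow> bool" where
  "C3 f \<longleftrightarrow> (\<forall>i<3. \<forall>x. (deriv ^^ i) f field_differentiable (at x))
            \<and> continuous_on UNIV ((deriv ^^ 3) f)"

definition mean_zero_L2 :: "'z measure \<Rightarrow> ('z \<Rightarrow> real) set" where
  "mean_zero_L2 P = {g \<in> borel_measurable P.
     integrable P (\<lambda>z. (g z)\<^sup>2) \<and> (\<integral>z. g z \<partial>P) = 0}"

definition tilt_const :: "(real \<Rightarrow> real) \<Rightarrow> 'z measure \<Rightarrow> ('z \<Rightarrow> real) \<Rightarrow> real \<Rightarrow> real" where
  "tilt_const \<phi> P g t = (\<integral>z. \<phi> (t * g z) \<partial>P)"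

(* A probability measure only when tilt_const \<phi> P g t > 0; this holds for all t near 0. *)
definition tilt :: "(real \<Rightarrow> real) \<Rightarrow> 'z measure \<Rightarrow> ('z \<Rightarrow> real) \<Rightarrow> real \<Rightarrow> 'z measure" where
  "tilt \<phi> P g t = density P (\<lambda>z. ennreal (\<phi> (t * g z) / tilt_const \<phi> P g t))"

(* The value of the parameter \<theta> is only ever constrained at P and at the tilted measures. *)
definition influence_function ::
  "(real \<Rightarrow> real) \<Rightarrow> 'z measure \<Rightarrow> ('z measure \<Rightarrow> real) \<Rightarrow> ('z \<Rightarrow> real) \<Rightarrow> bool" where
  "influence_function \<phi> P \<theta> \<psi> \<longleftrightarrow> \<psi> \<in> mean_zero_L2 P \<and>
     (\<forall>g \<in> mean_zero_L2 P.
        (\<lambda>t. \<theta> (tilt \<phi> P g t) - \<theta> P - t * (\<integral>z. \<psi> z * g z \<partial>P)) \<in> o[at 0](\<lambda>t. t))"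

(* Samples of size n are functions on {..<n}, extended by undefined outside. *)
definition iid :: "nat \<Rightarrow> 'z measure \<Rightarrow> (nat \<Rightarrow> 'z) measure" where
  "iid n P = (\<Pi>\<^sub>M i\<in>{..<n}. P)"

definition error_prob ::
  "('z measure \<Rightarrow> real) \<Rightarrow> real \<Rightarrow> nat \<Rightarrow> ((nat \<Rightarrow> 'z) \<Rightarrow> real) \<Rightarrow> 'z measure \<Rightarrow> real" where
  "error_prob \<theta> K n T P =
     measure (iid n P) {z \<in> space (iid n P). sqrt (real n) * \<bar>T z - \<theta> P\<bar> \<ge> K}"

definition directions :: "'z measure \<Rightarrow> ('z \<Rightarrow> real) \<Rightarrow> ('z \<Rightarrow> real) set" where
  "directions P \<psi> = {g \<in> mean_zero_L2 P.
     (\<integral>z. \<psi> z * g z \<partial>P) \<noteq> 0 \<and> (\<integral>z. (g z)\<^sup>2 \<partial>P) \<le> 1}"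

definition local_alternatives ::
  "(real \<Rightarrow> real) \<Rightarrow> 'z measure \<Rightarrow> ('z \<Rightarrow> real) \<Rightarrow> real \<Rightarrow> real \<Rightarrow> real \<Rightarrow> (nat \<Rightarrow> real)
    \<Rightarrow> nat \<Rightarrow> ('z \<Rightarrow> real) \<Rightarrow> 'z measure set" where
  "local_alternatives \<phi> P \<psi> K B c \<delta> n g =
     {tilt \<phi> P g t | t. tilt_const \<phi> P g t > 0
        \<and> K\<^sup>2 / real n * (B\<^sup>2 / (\<integral>z. \<psi> z * g z \<partial>P)\<^sup>2) \<le> t\<^sup>2
        \<and> t\<^sup>2 \<le> c / real n * ln (1 / \<delta> n)}"

(* Infimum of quantities in [0,1]: the infimum of the empty set is 1 (not \<infinity>). *)
definition unit_Inf :: "ereal set \<Rightarrow> ereal" where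
  "unit_Inf S = (if S = {} then 1 else Inf S)"

end

theory Submission
  imports Defs
begin

text \<open>For \<open>Q = P\<^bsub>t,g\<^esub>\<close> with \<open>t\<close> near \<open>0\<close>, the second moment of \<open>dQ/dP\<^sub>0\<close> is at most \<open>1 + q * t\<^sup>2\<close>
  for any fixed \<open>q > 1\<close>. By the Cauchy--Schwarz inequality an event of \<open>P\<^sub>0\<^sup>n\<close>-probability at most
  \<open>\<delta>\<close> has \<open>Q\<^sup>n\<close>-probability at most the square root of \<open>(1 + q * t\<^sup>2)\<^sup>n * \<delta> \<le> exp (q * n * t\<^sup>2) * \<delta>\<close>,
  and this is at most \<open>\<delta>\<close> to the power \<open>1 - q * c > 0\<close> when \<open>n * t\<^sup>2 \<le> c * ln (1 / \<delta>)\<close> and \<open>q < 1 / c\<close>.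
  Hence under \<open>Q\<^sup>n\<close> too the estimator is within \<open>K / sqrt n\<close> of \<open>\<theta> P\<^sub>0\<close> with probability tending
  to \<open>1\<close>, while the lower bound on \<open>t\<^sup>2\<close> and \<open>B > 2\<close> put \<open>\<theta> Q\<close> at distance at least \<open>2 * K / sqrt n\<close>
  from \<open>\<theta> P\<^sub>0\<close>.\<close>

section \<open>Densities on finite products and Cauchy--Schwarz for i.i.d. samples\<close>

lemma PiM_density:
  assumes "finite I" and "\<And>i. i \<in> I \<Longrightarrow> f i \<in> borel_measurable (M i)"
    and "product_sigma_finite M" and "product_sigma_finite (\<lambda>i. density (M i) (f i))"
  shows "PiM I (\<lambda>i. density (M i) (f i)) = density (PiM I M) (\<lambda>x. \<Prod>i\<in>I. f i (x i))"
proof -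
  interpret M: product_sigma_finite M by fact
  interpret D: product_sigma_finite "\<lambda>i. density (M i) (f i)" by fact
  note assms(2)[measurable]
  have f[measurable]: "(\<lambda>x. \<Prod>i\<in>I. f i (x i)) \<in> borel_measurable (PiM I M)"
    by (intro borel_measurable_prod_ennreal) measurable
  \<comment> \<open>A finite product of sigma-finite measures is determined by its values on boxes,
    so the two sides are compared there. Sigma-finiteness of the densities is a separate assumption,
    because \<open>f i\<close> may be infinite on a set of positive measure.\<close>
  have "density (PiM I M) (\<lambda>x. \<Prod>i\<in>I. f i (x i)) = PiM I (\<lambda>i. density (M i) (f i))"
  proof (rule D.PiM_eqI)
    show "finite I" by fact
    show "sets (density (PiM I M) (\<lambda>x. \<Prod>i\<in>I. f i (x i)))
        = sets (PiM I (\<lambda>i. density (M i) (f i)))"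
      unfolding sets_density by (intro sets_PiM_cong) auto
    fix A assume A: "\<And>i. i \<in> I \<Longrightarrow> A i \<in> sets (density (M i) (f i))"
    then have [measurable]: "\<And>i. i \<in> I \<Longrightarrow> A i \<in> sets (M i)" by simp
    have "emeasure (density (PiM I M) (\<lambda>x. \<Prod>i\<in>I. f i (x i))) (Pi\<^sub>E I A)
        = (\<integral>\<^sup>+x. (\<Prod>i\<in>I. f i (x i)) * indicator (Pi\<^sub>E I A) x \<partial>PiM I M)"
      using assms(1) by (intro emeasure_density f sets_PiM_I_finite) auto
    also have "\<dots> = (\<integral>\<^sup>+x. (\<Prod>i\<in>I. f i (x i) * indicator (A i) (x i)) \<partial>PiM I M)"
    proof (rule nn_integral_cong)
      fix x assume "x \<in> space (PiM I M)"
      \<comment> \<open>Points of the product space are already \<open>undefined\<close> outside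
        \<open>I\<close>, so lying in the box is a condition on the coordinates in \<open>I\<close>
        alone.\<close>
      then have "indicator (Pi\<^sub>E I A) x = (\<Prod>i\<in>I. indicator (A i) (x i) :: ennreal)"
        using assms(1)
        by (auto simp: indicator_def space_PiM PiE_def Pi_def)
      then show "(\<Prod>i\<in>I. f i (x i)) * indicator (Pi\<^sub>E I A) x
          = (\<Prod>i\<in>I. f i (x i) * indicator (A i) (x i))"
        by (simp add: prod.distrib)
    qed
    also have "\<dots> = (\<Prod>i\<in>I. \<integral>\<^sup>+x. f i x * indicator (A i) x \<partial>M i)"
      using assms(1) by (intro M.product_nn_integral_prod) measurable
    also have "\<dots> = (\<Prod>i\<in>I. emeasure (density (M i) (f i)) (A i))"
      by (intro prod.cong) (auto simp: emeasure_density)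
    finally show "emeasure (density (PiM I M) (\<lambda>x. \<Prod>i\<in>I. f i (x i))) (Pi\<^sub>E I A)
        = (\<Prod>i\<in>I. emeasure (density (M i) (f i)) (A i))" .
  qed
  then show ?thesis by simp
qed

text \<open>Cauchy--Schwarz for \<open>f\<close> against the indicator of \<open>A\<close>, which is
  its own square.\<close>

lemma emeasure_density_power2_le:
  assumes [measurable]: "f \<in> borel_measurable M" "A \<in> sets M"
  shows "(emeasure (density M f) A)\<^sup>2 \<le> (\<integral>\<^sup>+x. (f x)\<^sup>2 \<partial>M) * emeasure M A"
proof -
  have "(\<integral>\<^sup>+x. (indicator A x)\<^sup>2 \<partial>M) = (\<integral>\<^sup>+x. indicator A x \<partial>M)"
    by (intro nn_integral_cong) (auto simp: indicator_def)
  then show ?thesis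
    using Cauchy_Schwarz_nn_integral[of f M "indicator A"]
    by (simp add: emeasure_density)
qed

text \<open>The likelihood ratio of the sample is a product over coordinates, and so is its square.
  Its second moment is therefore the \<open>n\<close>-th power of that of a single factor: one plus
  the chi-square divergence tensorises.\<close>

lemma emeasure_iid_density_power2_le:
  assumes "prob_space P" "prob_space (density P f)"
    and [measurable]: "f \<in> borel_measurable P" and A: "A \<in> sets (iid n P)"
  shows "(emeasure (iid n (density P f)) A)\<^sup>2 \<le> (\<integral>\<^sup>+x. (f x)\<^sup>2 \<partial>P) ^ n * emeasure (iid n P) A"
proof -
  interpret P: prob_space P by fact
  interpret D: prob_space "density P f" by fact
  interpret PP: product_sigma_finite "\<lambda>i::nat. P" ..
  interpret DD: product_sigma_finite "\<lambda>i::nat. density P f" ..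
  have d: "iid n (density P f) = density (iid n P) (\<lambda>x. \<Prod>i<n. f (x i))"
    unfolding iid_def
    by (rule PiM_density) (auto intro: PP.product_sigma_finite_axioms DD.product_sigma_finite_axioms)
  have "(\<integral>\<^sup>+x. (\<Prod>i<n. f (x i))\<^sup>2 \<partial>iid n P) = (\<integral>\<^sup>+x. (\<Prod>i<n. (f (x i))\<^sup>2) \<partial>iid n P)"
    by (simp add: prod_power_distrib)
  also have "\<dots> = (\<integral>\<^sup>+x. (f x)\<^sup>2 \<partial>P) ^ n"
    unfolding iid_def
    by (subst PP.product_nn_integral_prod) auto
  finally have e: "(\<integral>\<^sup>+x. (\<Prod>i<n. f (x i))\<^sup>2 \<partial>iid n P) = (\<integral>\<^sup>+x. (f x)\<^sup>2 \<partial>P) ^ n" .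
  have "(\<lambda>x. \<Prod>i<n. f (x i)) \<in> borel_measurable (iid n P)"
    unfolding iid_def by (intro borel_measurable_prod_ennreal) measurable
  from emeasure_density_power2_le[OF this A] show ?thesis
    unfolding d e .
qed

lemma prob_space_iid: "prob_space P \<Longrightarrow> prob_space (iid n P)"
  unfolding iid_def by (rule prob_space_PiM)

section \<open>Tilted measures and the second moment of their density near
  \<open>t = 0\<close>\<close>

lemma integrable_tilt:
  fixes \<phi> :: "real \<Rightarrow> real"
  assumes "prob_space P" "\<phi> \<in> borel_measurable borel" "\<And>x. \<phi> x \<in> {0..2}"
    and "g \<in> borel_measurable P"
  shows "integrable P (\<lambda>z. \<phi> (t * g z))"
proof -
  interpret prob_space P by fact
  note assms(2,4)[measurable]
  show ?thesis
    by (rule integrable_const_bound[where B=2]) (use assms(3) in auto)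
qed

lemma prob_space_tilt:
  assumes "prob_space P" "\<phi> \<in> borel_measurable borel" "\<And>x. \<phi> x \<in> {0..2}"
    and "g \<in> borel_measurable P" and C: "tilt_const \<phi> P g t > 0"
  shows "prob_space (tilt \<phi> P g t)"
proof
  note assms(2,4)[measurable]
  have "emeasure (tilt \<phi> P g t) (space (tilt \<phi> P g t))
      = (\<integral>\<^sup>+z. ennreal (\<phi> (t * g z) / tilt_const \<phi> P g t) \<partial>P)"
    by (auto simp: tilt_def emeasure_density intro!: nn_integral_cong)
  also have "\<dots> = ennreal (\<integral>z. \<phi> (t * g z) / tilt_const \<phi> P g t \<partial>P)"
    using assms(3) C integrable_tilt[OF assms(1-4)]
    by (intro nn_integral_eq_integral) (auto intro!: divide_nonneg_pos)
  also have "\<dots> = 1"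
    using C by (simp add: tilt_const_def)
  finally show "emeasure (tilt \<phi> P g t) (space (tilt \<phi> P g t)) = 1" .
qed

text \<open>Dominated convergence with the constant bound 2, along arbitrary sequences tending to 0.
  When \<open>\<phi> 0 = 1\<close>, it makes the normalising constant positive near 0 and removes it
  from limits.\<close>

lemma tilt_const_tendsto:
  assumes "prob_space P" "\<And>x. \<phi> x \<in> {0..2}" "continuous_on UNIV \<phi>" "g \<in> borel_measurable P"
  shows "(tilt_const \<phi> P g \<longlongrightarrow> \<phi> 0) (at 0)"
  unfolding tendsto_at_iff_sequentially
proof safe
  interpret prob_space P by fact
  have [measurable]: "\<phi> \<in> borel_measurable borel"
    by (rule borel_measurable_continuous_onI) fact
  note assms(4)[measurable]
  fix X :: "nat \<Rightarrow> real" assume X: "X \<longlonglongrightarrow> 0"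
  have "(\<lambda>n. \<integral>z. \<phi> (X n * g z) \<partial>P) \<longlonglongrightarrow> (\<integral>z. \<phi> 0 \<partial>P)"
  proof (rule integral_dominated_convergence[where w="\<lambda>_. 2"])
    show "AE z in P. (\<lambda>n. \<phi> (X n * g z)) \<longlonglongrightarrow> \<phi> 0"
    proof (rule AE_I2)
      fix z
      have "(\<lambda>n. X n * g z) \<longlonglongrightarrow> 0" using X by (auto intro: tendsto_mult_left_zero)
      moreover have "isCont \<phi> 0"
        using assms(3) by (simp add: continuous_on_eq_continuous_at)
      ultimately show "(\<lambda>n. \<phi> (X n * g z)) \<longlonglongrightarrow> \<phi> 0"
        using isCont_tendsto_compose by blast
    qed
  qed (use assms(2) in auto)
  then show "(tilt_const \<phi> P g \<circ> X) \<longlonglongrightarrow> \<phi> 0"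
    by (simp add: tilt_const_def comp_def prob_space)
qed

text \<open>Differentiability at 0 in mean square. The difference quotients converge pointwise to
  \<open>d * g z\<close>, and the linear growth bound dominates their squares by
  \<open>(M * g z)\<^sup>2\<close>, which is integrable and does not depend on
  \<open>t\<close>.\<close>

lemma tilt_increment_tendsto:
  assumes "prob_space P" "continuous_on UNIV \<phi>" "(\<phi> has_real_derivative d) (at 0)"
    and lip: "\<And>x. \<bar>\<phi> x - \<phi> 0\<bar> \<le> M * \<bar>x\<bar>"
    and [measurable]: "g \<in> borel_measurable P" and g2: "integrable P (\<lambda>z. (g z)\<^sup>2)"
  shows "((\<lambda>t. (\<integral>z. (\<phi> (t * g z) - \<phi> 0)\<^sup>2 \<partial>P) / t\<^sup>2) \<longlongrightarrow> d\<^sup>2 * (\<integral>z. (g z)\<^sup>2 \<partial>P)) (at 0)"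
  unfolding tendsto_at_iff_sequentially
proof safe
  interpret prob_space P by fact
  have [measurable]: "\<phi> \<in> borel_measurable borel"
    by (rule borel_measurable_continuous_onI) fact
  have M: "0 \<le> M" using lip[of 1] by simp
  fix X :: "nat \<Rightarrow> real" assume X0: "\<forall>i. X i \<in> UNIV - {0}" and X: "X \<longlonglongrightarrow> 0"
  have "(\<lambda>n. \<integral>z. ((\<phi> (X n * g z) - \<phi> 0) / X n)\<^sup>2 \<partial>P) \<longlonglongrightarrow> (\<integral>z. (d * g z)\<^sup>2 \<partial>P)"
  proof (rule integral_dominated_convergence[where w="\<lambda>z. (M * g z)\<^sup>2"])
    show "integrable P (\<lambda>z. (M * g z)\<^sup>2)"
      using g2 by (simp add: power_mult_distrib)
    show "AE z in P. norm (((\<phi> (X n * g z) - \<phi> 0) / X n)\<^sup>2) \<le> (M * g z)\<^sup>2" for n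
    proof (rule AE_I2)
      fix z
      have "\<bar>(\<phi> (X n * g z) - \<phi> 0) / X n\<bar> \<le> \<bar>M * g z\<bar>"
        using lip[of "X n * g z"] X0 M by (simp add: abs_mult field_simps)
      then show "norm (((\<phi> (X n * g z) - \<phi> 0) / X n)\<^sup>2) \<le> (M * g z)\<^sup>2"
        unfolding abs_le_square_iff by simp
    qed
    show "AE z in P. (\<lambda>n. ((\<phi> (X n * g z) - \<phi> 0) / X n)\<^sup>2) \<longlonglongrightarrow> (d * g z)\<^sup>2"
    proof (intro AE_I2 tendsto_power)
      fix z
      have "((\<lambda>t. \<phi> (t * g z)) has_real_derivative d * g z) (at 0)"
        by (rule DERIV_chain'[where g=\<phi>, THEN DERIV_cong]) (auto intro!: derivative_eq_intros assms(3))
      then have "((\<lambda>t. (\<phi> (t * g z) - \<phi> 0) / t) \<longlongrightarrow> d * g z) (at 0)"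
        by (simp add: has_field_derivative_iff)
      then show "(\<lambda>n. (\<phi> (X n * g z) - \<phi> 0) / X n) \<longlonglongrightarrow> d * g z"
        using X0 X by (auto simp: tendsto_at_iff_sequentially comp_def)
    qed
  qed measurable
  then show "((\<lambda>t. (\<integral>z. (\<phi> (t * g z) - \<phi> 0)\<^sup>2 \<partial>P) / t\<^sup>2) \<circ> X)
      \<longlonglongrightarrow> d\<^sup>2 * (\<integral>z. (g z)\<^sup>2 \<partial>P)"
    by (simp add: comp_def power_divide power_mult_distrib)
qed

text \<open>Since \<open>tilt_const\<close> is the mean of \<open>\<phi> (t * g z)\<close>, the second moment of the density exceeds
  \<open>1\<close> by a normalised variance, which is at most the normalised mean of \<open>(\<phi> (t * g z) - 1)\<^sup>2\<close>.\<close>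
lemma tilt_second_moment_le:
  assumes "prob_space P" "\<And>x. \<phi> x \<in> {0..2}" "continuous_on UNIV \<phi>"
    and "\<phi> 0 = 1" "(\<phi> has_real_derivative 1) (at 0)"
    and "\<And>x. \<bar>\<phi> x - 1\<bar> \<le> M * \<bar>x\<bar>"
    and "g \<in> mean_zero_L2 P" "(\<integral>z. (g z)\<^sup>2 \<partial>P) < q"
  shows "\<forall>\<^sub>F t in at 0.
    (\<integral>\<^sup>+z. (ennreal (\<phi> (t * g z) / tilt_const \<phi> P g t))\<^sup>2 \<partial>P) \<le> ennreal (1 + q * t\<^sup>2)"
proof -
  interpret prob_space P by fact
  have phi[measurable]: "\<phi> \<in> borel_measurable borel"
    by (rule borel_measurable_continuous_onI) fact
  have g[measurable]: "g \<in> borel_measurable P" and g2: "integrable P (\<lambda>z. (g z)\<^sup>2)"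
    using assms(7) by (auto simp: mean_zero_L2_def)
  define C where "C = tilt_const \<phi> P g"
  define D where "D t = (\<integral>z. (\<phi> (t * g z) - 1)\<^sup>2 \<partial>P)" for t
  have C: "(C \<longlongrightarrow> 1) (at 0)"
    using tilt_const_tendsto[OF assms(1-3) g] assms(4) by (simp add: C_def)
  have D: "((\<lambda>t. D t / t\<^sup>2) \<longlongrightarrow> (\<integral>z. (g z)\<^sup>2 \<partial>P)) (at 0)"
    using tilt_increment_tendsto[OF assms(1,3,5) _ g g2, of M] assms(4,6) by (simp add: D_def)
  have "((\<lambda>t. D t / t\<^sup>2 / (C t)\<^sup>2) \<longlongrightarrow> (\<integral>z. (g z)\<^sup>2 \<partial>P) / 1\<^sup>2) (at 0)"
    by (intro tendsto_intros C D) auto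
  \<comment> \<open>The limit is the second moment of \<open>g\<close> itself, so the strict gap
    below \<open>q\<close> absorbs the remainder and the normalisation.\<close>
  then have "\<forall>\<^sub>F t in at 0. D t / t\<^sup>2 / (C t)\<^sup>2 < q"
    using assms(8) by (intro order_tendstoD(2)[where y="(\<integral>z. (g z)\<^sup>2 \<partial>P) / 1\<^sup>2"]) auto
  moreover have "\<forall>\<^sub>F t in at 0. C t > 0"
    using order_tendstoD(1)[OF C] by simp
  moreover have "\<forall>\<^sub>F t :: real in at 0. t \<noteq> 0"
    by (simp add: eventually_at_filter)
  ultimately show ?thesis
  proof eventually_elim
    case (elim t)
    have i1: "integrable P (\<lambda>z. \<phi> (t * g z))"
      by (rule integrable_tilt[OF assms(1) phi assms(2) g])
    have i2: "integrable P (\<lambda>z. (\<phi> (t * g z))\<^sup>2)"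
    proof (rule integrable_const_bound[where B=4])
      show "AE z in P. norm ((\<phi> (t * g z))\<^sup>2) \<le> 4"
        using assms(2) power_mono[of "\<phi> _" 2 2] by auto
    qed measurable
    have "D t = (\<integral>z. (\<phi> (t * g z))\<^sup>2 - 2 * \<phi> (t * g z) + 1 \<partial>P)"
      unfolding D_def by (intro Bochner_Integration.integral_cong) (auto simp: power2_eq_square algebra_simps)
    also have "\<dots> = (\<integral>z. (\<phi> (t * g z))\<^sup>2 \<partial>P) - 2 * C t + 1"
      using i1 i2 by (simp add: C_def tilt_const_def prob_space)
    \<comment> \<open>The mean squared deviation \<open>D t\<close> from 1 is the variance plus the
      squared bias \<open>(C t - 1)\<^sup>2\<close>; the bias is dropped next.\<close>
    finally have "(\<integral>z. (\<phi> (t * g z))\<^sup>2 \<partial>P) = (C t)\<^sup>2 + D t - (C t - 1)\<^sup>2"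
      by (simp add: power2_eq_square algebra_simps)
    also have "\<dots> \<le> (C t)\<^sup>2 + D t" by simp
    finally have "(\<integral>z. (\<phi> (t * g z))\<^sup>2 \<partial>P) / (C t)\<^sup>2 \<le> 1 + D t / (C t)\<^sup>2"
      using elim by (simp add: field_simps)
    moreover have "D t / (C t)\<^sup>2 \<le> q * t\<^sup>2"
      using elim by (simp add: field_simps)
    ultimately have le: "(\<integral>z. (\<phi> (t * g z) / C t)\<^sup>2 \<partial>P) \<le> 1 + q * t\<^sup>2"
      by (simp add: power_divide)
    have "(\<integral>\<^sup>+z. (ennreal (\<phi> (t * g z) / C t))\<^sup>2 \<partial>P)
        = (\<integral>\<^sup>+z. ennreal ((\<phi> (t * g z) / C t)\<^sup>2) \<partial>P)"
      using elim assms(2) by (intro nn_integral_cong ennreal_power) (auto intro!: divide_nonneg_pos)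
    also have "\<dots> = ennreal (\<integral>z. (\<phi> (t * g z) / C t)\<^sup>2 \<partial>P)"
      using i2 by (intro nn_integral_eq_integral) (auto simp: power_divide)
    finally show ?case using le by (simp add: C_def ennreal_leI)
  qed
qed

lemma abs_diff_le_of_deriv_bound:
  fixes f :: "real \<Rightarrow> real"
  assumes "\<And>x. f field_differentiable (at x)" "\<And>x. \<bar>deriv f x\<bar> \<le> M"
  shows "\<bar>f x - f y\<bar> \<le> M * \<bar>x - y\<bar>"
  using field_differentiable_bound[of UNIV f "deriv f" M x y] assms
  by (auto simp: DERIV_deriv_iff_field_differentiable)

section \<open>Transfer of the error probability to a local alternative\<close>

lemma error_prob_le_1: "prob_space P \<Longrightarrow> error_prob \<theta> K n T P \<le> 1"
  unfolding error_prob_def by (intro prob_space.prob_le_1 prob_space_iid)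

text \<open>An estimate strictly within \<open>K / sqrt n\<close> of \<open>\<theta> P\<close> is at
  least \<open>K / sqrt n\<close> away from the other parameter value, by the triangle inequality
  and the separation \<open>2 * K\<close>. So failure under the new law is at least as likely as the
  complement of \<open>A\<close>, and the change of measure bounds the probability of
  \<open>A\<close>.\<close>

lemma error_prob_density_ge:
  fixes P :: "'z measure"
  assumes P: "prob_space P" and Q: "prob_space (density P f)"
    and f: "f \<in> borel_measurable P" and T: "T \<in> borel_measurable (iid n P)"
    and sep: "sqrt (real n) * \<bar>\<theta> (density P f) - \<theta> P\<bar> \<ge> 2 * K"
    and m: "(\<integral>\<^sup>+x. (f x)\<^sup>2 \<partial>P) \<le> ennreal s" and s: "0 \<le> s"
  shows "error_prob \<theta> K n T (density P f) \<ge> 1 - sqrt (s ^ n * error_prob \<theta> K n T P)"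
proof -
  let ?Q = "density P f"
  interpret P: prob_space "iid n P" by (rule prob_space_iid) fact
  interpret Q: prob_space "iid n ?Q" by (rule prob_space_iid) fact
  have sets: "sets (iid n ?Q) = sets (iid n P)"
    unfolding iid_def by (intro sets_PiM_cong) auto
  then have sp: "space (iid n ?Q) = space (iid n P)" by (rule sets_eq_imp_space_eq)
  note T[measurable]
  define A where "A = {z \<in> space (iid n P). sqrt (real n) * \<bar>T z - \<theta> P\<bar> \<ge> K}"
  define E where "E = {z \<in> space (iid n P). sqrt (real n) * \<bar>T z - \<theta> ?Q\<bar> \<ge> K}"
  have A[measurable]: "A \<in> sets (iid n P)" and E: "E \<in> sets (iid n P)"
    unfolding A_def E_def by measurable
  have sub: "space (iid n ?Q) - A \<subseteq> E"
  proof safe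
    fix z assume z: "z \<in> space (iid n ?Q)" "z \<notin> A"
    have "sqrt (real n) * \<bar>\<theta> ?Q - \<theta> P\<bar> \<le> sqrt (real n) * (\<bar>T z - \<theta> P\<bar> + \<bar>T z - \<theta> ?Q\<bar>)"
      by (intro mult_left_mono) auto
    then show "z \<in> E" using z sep unfolding A_def E_def sp by (auto simp: algebra_simps)
  qed
  have "ennreal ((measure (iid n ?Q) A)\<^sup>2) = (emeasure (iid n ?Q) A)\<^sup>2"
    by (simp add: Q.emeasure_eq_measure ennreal_power)
  also have "\<dots> \<le> (\<integral>\<^sup>+x. (f x)\<^sup>2 \<partial>P) ^ n * emeasure (iid n P) A"
    by (rule emeasure_iid_density_power2_le[OF P Q f A])
  also have "\<dots> \<le> ennreal s ^ n * emeasure (iid n P) A"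
    by (intro mult_right_mono power_mono m) auto
  also have "\<dots> = ennreal (s ^ n * measure (iid n P) A)"
    using s by (simp add: P.emeasure_eq_measure ennreal_power ennreal_mult)
  finally have "(measure (iid n ?Q) A)\<^sup>2 \<le> s ^ n * measure (iid n P) A"
    using s by (simp add: ennreal_le_iff)
  then have "measure (iid n ?Q) A \<le> sqrt (s ^ n * measure (iid n P) A)"
    by (rule real_le_rsqrt)
  moreover have "1 - measure (iid n ?Q) A = measure (iid n ?Q) (space (iid n ?Q) - A)"
    using Q.prob_compl[of A] A sets by simp
  moreover have "\<dots> \<le> measure (iid n ?Q) E"
    using E sets sub by (intro Q.finite_measure_mono) auto
  ultimately show ?thesis
    by (simp add: error_prob_def A_def E_def sp)
qed

text \<open>The lower bound is 1 minus the square root of \<open>\<delta> n\<close> raised to the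
  power \<open>(1 - c) / 2\<close>. It is the same for all alternatives at sample size
  \<open>n\<close>, since the local estimates hold for all nonzero \<open>t\<close> within a radius
  \<open>r\<close> that does not depend on \<open>n\<close>.\<close>

lemma eventually_error_prob_alternatives_ge:
  fixes P :: "'z measure" and \<delta> :: "nat \<Rightarrow> real"
  assumes P: "prob_space P"
    and bd: "\<And>x. \<phi> x \<in> {0..2}" and cont: "continuous_on UNIV \<phi>"
    and phi: "\<phi> 0 = 1" "(\<phi> has_real_derivative 1) (at 0)" "\<And>x. \<bar>\<phi> x - 1\<bar> \<le> M * \<bar>x\<bar>"
    and infl: "influence_function \<phi> P \<theta> \<psi>"
    and K: "K > 0" and B: "B > 2" and c: "0 < c" "c < 1"
    and T: "\<And>n. n \<ge> 1 \<Longrightarrow> T n \<in> borel_measurable (iid n P)"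
    and err: "\<And>n. n \<ge> 1 \<Longrightarrow> error_prob \<theta> K n (T n) P \<le> \<delta> n"
    and \<delta>: "\<And>n. n \<ge> 1 \<Longrightarrow> \<delta> n > 0"
    and log: "(\<lambda>n. ln (\<delta> n) / real n) \<longlonglongrightarrow> 0"
    and g: "g \<in> directions P \<psi>"
  shows "\<forall>\<^sub>F n in sequentially. \<forall>Q \<in> local_alternatives \<phi> P \<psi> K B c \<delta> n g.
    1 - sqrt (exp ((1 - c) / 2 * ln (\<delta> n))) \<le> error_prob \<theta> K n (T n) Q"
proof -
  define a where "a = (\<integral>z. \<psi> z * g z \<partial>P)"
  \<comment> \<open>This value lies strictly between 1 and \<open>1 / c\<close>. Being above 1
    leaves room over the second moment of \<open>g\<close>; being below \<open>1 / c\<close> leaves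
    the positive exponent \<open>1 - q * c = (1 - c) / 2\<close>.\<close>
  define q where "q = (1 + c) / (2 * c)"
  have a: "a \<noteq> 0" and gL: "g \<in> mean_zero_L2 P" and g1: "(\<integral>z. (g z)\<^sup>2 \<partial>P) \<le> 1"
    using g by (auto simp: directions_def a_def)
  have q: "1 < q" "0 < q" "q * c = (1 + c) / 2"
    using c by (auto simp: q_def field_simps)
  have [measurable]: "\<phi> \<in> borel_measurable borel" "g \<in> borel_measurable P"
    using gL borel_measurable_continuous_onI[OF cont] by (auto simp: mean_zero_L2_def)
  have "\<forall>\<^sub>F t in at 0.
      (\<integral>\<^sup>+z. (ennreal (\<phi> (t * g z) / tilt_const \<phi> P g t))\<^sup>2 \<partial>P) \<le> ennreal (1 + q * t\<^sup>2)"
    using g1 q by (intro tilt_second_moment_le[OF P bd cont phi gL]) auto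
  moreover have "(\<lambda>t. \<theta> (tilt \<phi> P g t) - \<theta> P - t * a) \<in> o[at 0](\<lambda>t. t)"
    using infl gL by (auto simp: influence_function_def a_def)
  \<comment> \<open>The tolerance is positive because \<open>B > 2\<close> and \<open>a\<close> is
    nonzero. It preserves the fraction \<open>2 / B\<close> of the linear term
    \<open>\<bar>t * a\<bar>\<close>, which turns the lower bound \<open>K * B\<close> into the
    separation \<open>2 * K\<close>.\<close>
  then have "\<forall>\<^sub>F t in at 0. norm (\<theta> (tilt \<phi> P g t) - \<theta> P - t * a) \<le> (1 - 2 / B) * \<bar>a\<bar> * norm t"
    by (rule landau_o.smallD) (use a B in \<open>auto simp: field_simps\<close>)
  ultimately have "\<forall>\<^sub>F t in at 0.
      (\<integral>\<^sup>+z. (ennreal (\<phi> (t * g z) / tilt_const \<phi> P g t))\<^sup>2 \<partial>P) \<le> ennreal (1 + q * t\<^sup>2) \<and>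
      \<bar>\<theta> (tilt \<phi> P g t) - \<theta> P - t * a\<bar> \<le> (1 - 2 / B) * \<bar>a\<bar> * \<bar>t\<bar>"
    by eventually_elim auto
  then obtain r where r: "r > 0" and good: "\<And>t. t \<noteq> 0 \<Longrightarrow> \<bar>t\<bar> < r \<Longrightarrow>
      (\<integral>\<^sup>+z. (ennreal (\<phi> (t * g z) / tilt_const \<phi> P g t))\<^sup>2 \<partial>P) \<le> ennreal (1 + q * t\<^sup>2)"
    "\<And>t. t \<noteq> 0 \<Longrightarrow> \<bar>t\<bar> < r \<Longrightarrow>
      \<bar>\<theta> (tilt \<phi> P g t) - \<theta> P - t * a\<bar> \<le> (1 - 2 / B) * \<bar>a\<bar> * \<bar>t\<bar>"
    unfolding eventually_at by (auto simp: dist_real_def)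
  \<comment> \<open>This sequence is the upper end of the admissible range of
    \<open>t\<^sup>2\<close>, so for large \<open>n\<close> every admissible \<open>t\<close> lies
    within \<open>r\<close> of 0.\<close>
  have "(\<lambda>n. - c * (ln (\<delta> n) / real n)) \<longlonglongrightarrow> - c * 0"
    by (intro tendsto_intros log)
  then have "\<forall>\<^sub>F n in sequentially. - c * (ln (\<delta> n) / real n) < r\<^sup>2"
    using r by (intro order_tendstoD) auto
  then show ?thesis
    using eventually_ge_at_top[of 1]
  proof eventually_elim
    case (elim n)
    note \<delta>n = \<delta>[OF elim(2)]
    show ?case
    proof safe
      fix Q assume "Q \<in> local_alternatives \<phi> P \<psi> K B c \<delta> n g"
      then obtain t where Q: "Q = tilt \<phi> P g t" and C: "tilt_const \<phi> P g t > 0"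
        and lo: "K\<^sup>2 / real n * (B\<^sup>2 / a\<^sup>2) \<le> t\<^sup>2"
        and hi: "t\<^sup>2 \<le> c / real n * ln (1 / \<delta> n)"
        by (auto simp: local_alternatives_def a_def)
      have lo': "K * B \<le> sqrt (real n) * \<bar>t\<bar> * \<bar>a\<bar>"
      proof (rule power2_le_imp_le)
        show "(K * B)\<^sup>2 \<le> (sqrt (real n) * \<bar>t\<bar> * \<bar>a\<bar>)\<^sup>2"
          using lo a elim(2) by (simp add: power_mult_distrib field_simps)
      qed simp
      \<comment> \<open>The local estimates hold in a punctured neighbourhood, so
        \<open>t = 0\<close> must be excluded; the lower bound on \<open>t\<^sup>2\<close> does
        this.\<close>
      moreover have "0 < K * B" using K B by simp
      ultimately have t0: "t \<noteq> 0" by auto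
      have hi': "real n * t\<^sup>2 \<le> - c * ln (\<delta> n)"
        using hi elim(2) \<delta>n by (simp add: ln_div field_simps)
      have "real n * (- c * (ln (\<delta> n) / real n)) < real n * r\<^sup>2"
        using elim(1,2) by (intro mult_strict_left_mono) auto
      then have "- c * ln (\<delta> n) < real n * r\<^sup>2"
        using elim(2) by simp
      with hi' have "real n * t\<^sup>2 < real n * r\<^sup>2"
        by (rule le_less_trans)
      then have "\<bar>t\<bar>\<^sup>2 < r\<^sup>2"
        using elim(2) by simp
      then have tr: "\<bar>t\<bar> < r"
        by (rule power2_less_imp_less) (use r in simp)
      let ?d = "\<theta> (tilt \<phi> P g t) - \<theta> P"
      have "\<bar>t * a\<bar> - \<bar>?d\<bar> \<le> (1 - 2 / B) * \<bar>a\<bar> * \<bar>t\<bar>"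
        using good(2)[OF t0 tr] by linarith
      then have "2 / B * (\<bar>t\<bar> * \<bar>a\<bar>) \<le> \<bar>?d\<bar>"
        by (simp add: abs_mult algebra_simps)
      then have "sqrt (real n) * (2 / B * (\<bar>t\<bar> * \<bar>a\<bar>)) \<le> sqrt (real n) * \<bar>?d\<bar>"
        by (intro mult_left_mono) auto
      moreover have "2 / B * (K * B) \<le> 2 / B * (sqrt (real n) * \<bar>t\<bar> * \<bar>a\<bar>)"
        using lo' B by (intro mult_left_mono) auto
      ultimately have sep: "2 * K \<le> sqrt (real n) * \<bar>?d\<bar>"
        using B by (simp add: mult_ac)
      have "1 - sqrt ((1 + q * t\<^sup>2) ^ n * error_prob \<theta> K n (T n) P) \<le> error_prob \<theta> K n (T n) Q"
        unfolding Q tilt_def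
      proof (rule error_prob_density_ge[OF P _ _ T[OF elim(2)]])
        show "prob_space (density P (\<lambda>z. ennreal (\<phi> (t * g z) / tilt_const \<phi> P g t)))"
          using prob_space_tilt[of P \<phi> g t] P bd C by (simp add: tilt_def)
      qed (use sep good(1)[OF t0 tr] q in \<open>auto simp: tilt_def\<close>)
      moreover have "(1 + q * t\<^sup>2) ^ n * error_prob \<theta> K n (T n) P \<le> exp ((1 - c) / 2 * ln (\<delta> n))"
      proof -
        \<comment> \<open>Powers of \<open>\<delta> n\<close> are written as exponentials of
          multiples of \<open>ln (\<delta> n)\<close>: the likelihood factor costs the power
          \<open>- q * c\<close>, and the error bound under \<open>P\<close> contributes one full
          power.\<close>
        have "(1 + q * t\<^sup>2) ^ n \<le> exp (q * t\<^sup>2) ^ n"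
          using q by (intro power_mono exp_ge_add_one_self) auto
        also have "\<dots> = exp (q * (real n * t\<^sup>2))"
          by (simp add: exp_of_nat_mult[symmetric] mult_ac)
        also have "\<dots> \<le> exp (q * (- c * ln (\<delta> n)))"
          using mult_left_mono[OF hi', of q] q(2) by simp
        also have "q * (- c * ln (\<delta> n)) = - (q * c) * ln (\<delta> n)"
          by simp
        also note q(3)
        finally have "(1 + q * t\<^sup>2) ^ n * error_prob \<theta> K n (T n) P
            \<le> exp (- ((1 + c) / 2) * ln (\<delta> n)) * \<delta> n"
          using err[OF elim(2)] by (intro mult_mono) (auto simp: error_prob_def)
        also have "\<dots> = exp (- ((1 + c) / 2) * ln (\<delta> n) + ln (\<delta> n))"
          using \<delta>n by (simp only: exp_add exp_ln)
        also have "- ((1 + c) / 2) * ln (\<delta> n) + ln (\<delta> n) = (1 - c) / 2 * ln (\<delta> n)"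
          by (simp add: field_simps)
        finally show ?thesis .
      qed
      then have "sqrt ((1 + q * t\<^sup>2) ^ n * error_prob \<theta> K n (T n) P)
          \<le> sqrt (exp ((1 - c) / 2 * ln (\<delta> n)))"
        by (rule real_sqrt_le_mono)
      ultimately show "1 - sqrt (exp ((1 - c) / 2 * ln (\<delta> n))) \<le> error_prob \<theta> K n (T n) Q"
        by linarith
    qed
  qed
qed

section \<open>Infima in the unit interval and passage to the limit\<close>

lemma unit_Inf_le_1: "(\<And>x. x \<in> S \<Longrightarrow> x \<le> 1) \<Longrightarrow> unit_Inf S \<le> 1"
  unfolding unit_Inf_def by (auto intro: Inf_lower2)

text \<open>The premise \<open>x \<le> 1\<close> covers the empty set, whose infimum is 1 by
  convention.\<close>

lemma unit_Inf_greatest: "x \<le> 1 \<Longrightarrow> (\<And>y. y \<in> S \<Longrightarrow> x \<le> y) \<Longrightarrow> x \<le> unit_Inf S"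
  unfolding unit_Inf_def by (auto intro: Inf_greatest)

theorem proposition3:
  fixes P\<^sub>0 :: "'z measure"
    and \<theta> :: "'z measure \<Rightarrow> real"
    and \<psi> :: "'z \<Rightarrow> real"
    and \<phi> :: "real \<Rightarrow> real"
    and K B c M :: real
    and T :: "nat \<Rightarrow> (nat \<Rightarrow> 'z) \<Rightarrow> real"
    and \<epsilon> \<delta> :: "nat \<Rightarrow> real"
  assumes "prob_space P\<^sub>0"
    and "C3 \<phi>" "\<And>x. \<phi> x \<in> {0..2}" "\<phi> 0 = 1" "deriv \<phi> 0 = 1"
    and "\<And>x. \<bar>deriv \<phi> x\<bar> \<le> M" "\<And>x. \<bar>deriv (deriv \<phi>) x\<bar> \<le> M"
    and "influence_function \<phi> P\<^sub>0 \<theta> \<psi>"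
    and "K > 0" "B > 2" "0 < c" "c < 1"
    and "\<And>n. n \<ge> 1 \<Longrightarrow> T n \<in> borel_measurable (iid n P\<^sub>0)"
    and "\<And>n. n \<ge> 1 \<Longrightarrow> error_prob \<theta> K n (T n) P\<^sub>0 \<le> \<epsilon> n"
    and "\<epsilon> \<longlonglongrightarrow> 0"
    and "\<And>n. n \<ge> 1 \<Longrightarrow> \<delta> n > 0"
    and "\<And>n. n \<ge> 1 \<Longrightarrow> \<delta> n \<ge> \<epsilon> n"
    and "\<delta> \<longlonglongrightarrow> 0"
    and "(\<lambda>n. ln (\<delta> n) / real n) \<longlonglongrightarrow> 0"
  shows "unit_Inf ((\<lambda>g. liminf (\<lambda>n.
           unit_Inf ((\<lambda>P. ereal (error_prob \<theta> K n (T n) P))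
                       ` local_alternatives \<phi> P\<^sub>0 \<psi> K B c \<delta> n g)))
         ` directions P\<^sub>0 \<psi>) = 1"
proof -
  note P = assms(1) and bd = assms(3)
  have diff: "\<phi> field_differentiable (at x)" for x
    using assms(2) unfolding C3_def by (metis funpow_0 zero_less_numeral)
  then have cont: "continuous_on UNIV \<phi>"
    by (meson continuous_at_imp_continuous_on field_differentiable_imp_continuous_at)
  have deriv: "(\<phi> has_real_derivative 1) (at 0)"
    using diff[of 0] assms(5) by (simp flip: DERIV_deriv_iff_field_differentiable)
  have lip: "\<bar>\<phi> x - 1\<bar> \<le> M * \<bar>x\<bar>" for x
    using abs_diff_le_of_deriv_bound[of \<phi> M x 0, OF diff assms(6)] assms(4) by simp
  \<comment> \<open>The limit inferior is 1 for each direction separately, so the outer infimum is 1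
    whether or not any direction exists.\<close>
  have "liminf (\<lambda>n. unit_Inf ((\<lambda>P. ereal (error_prob \<theta> K n (T n) P))
          ` local_alternatives \<phi> P\<^sub>0 \<psi> K B c \<delta> n g)) = 1" (is "liminf ?F = 1")
    if g: "g \<in> directions P\<^sub>0 \<psi>" for g
  proof (rule antisym)
    have "?F n \<le> 1" for n
    proof (rule unit_Inf_le_1, safe)
      fix Q assume "Q \<in> local_alternatives \<phi> P\<^sub>0 \<psi> K B c \<delta> n g"
      \<comment> \<open>Membership includes positivity of the normalising constant, which makes the
        tilt a probability measure.\<close>
      then have "prob_space Q"
        using g borel_measurable_continuous_onI[OF cont]
        by (auto simp: local_alternatives_def directions_def mean_zero_L2_def
            intro!: prob_space_tilt P bd)
      then show "ereal (error_prob \<theta> K n (T n) Q) \<le> 1"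
        by (simp add: error_prob_le_1 one_ereal_def)
    qed
    then have "liminf ?F \<le> liminf (\<lambda>_. 1)"
      by (intro Liminf_mono always_eventually) blast
    then show "liminf ?F \<le> 1" by (simp add: Liminf_const)
  next
    let ?b = "\<lambda>n. 1 - sqrt (exp ((1 - c) / 2 * ln (\<delta> n)))"
    have err: "error_prob \<theta> K n (T n) P\<^sub>0 \<le> \<delta> n" if "n \<ge> 1" for n
      using assms(14,17)[OF that] by linarith
    \<comment> \<open>As \<open>\<delta> n\<close> tends to 0 through positive values, its logarithm
      tends to minus infinity; the factor \<open>(1 - c) / 2\<close> is positive because
      \<open>c < 1\<close>, so the power of \<open>\<delta> n\<close> vanishes.\<close>
    have "filterlim (\<lambda>n. ln (\<delta> n)) at_bot sequentially"
      using assms(16,18)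
      by (intro filterlim_compose[OF ln_at_0] tendsto_imp_filterlim_at_right)
        (auto intro: eventually_sequentiallyI)
    then have "filterlim (\<lambda>n. (1 - c) / 2 * ln (\<delta> n)) at_bot sequentially"
      using \<open>c < 1\<close> by (intro filterlim_tendsto_pos_mult_at_bot[OF tendsto_const]) auto
    then have "(\<lambda>n. exp ((1 - c) / 2 * ln (\<delta> n))) \<longlonglongrightarrow> 0"
      by (rule filterlim_compose[OF exp_at_bot])
    then have "?b \<longlonglongrightarrow> 1 - sqrt 0"
      by (intro tendsto_intros)
    then have "liminf (\<lambda>n. ereal (?b n)) = 1"
      by (intro lim_imp_Liminf) (auto simp: one_ereal_def)
    moreover have "\<forall>\<^sub>F n in sequentially. \<forall>Q \<in> local_alternatives \<phi> P\<^sub>0 \<psi> K B c \<delta> n g.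
        ?b n \<le> error_prob \<theta> K n (T n) Q"
      by (rule eventually_error_prob_alternatives_ge[where M=M and \<phi>=\<phi> and \<theta>=\<theta> and K=K and T=T])
        (fact assms P cont deriv lip err g)+
    \<comment> \<open>\<open>?b n\<close> never exceeds 1, so the bound also holds at sample sizes
      without alternatives.\<close>
    then have "\<forall>\<^sub>F n in sequentially. ereal (?b n) \<le> ?F n"
      by eventually_elim (auto intro!: unit_Inf_greatest simp: one_ereal_def)
    then have "liminf (\<lambda>n. ereal (?b n)) \<le> liminf ?F"
      by (rule Liminf_mono)
    ultimately show "1 \<le> liminf ?F" by simp
  qed
  then show ?thesis
    by (intro antisym unit_Inf_le_1 unit_Inf_greatest) auto
qed

end
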